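(* There is a constant $C>0$ such that for every $N\ge 1$ and every $f\in L^2(\mathbb{T}^2)$, $$ \|e^{it\Box}P_{\le N}f\|_{L^4(\mathbb{T}\times\mathbb{T}^2)}\le C\,N^{1/4}\,\|f\|_{L^2(\mathbb{T}^2)} . $$
   Context: Here $\mathbb{T}=\mathbb{R}/\mathbb{Z}$ (time variable $t$) and $\mathbb{T}^2=\mathbb{R}^2/\mathbb{Z}^2$. Fourier coefficients are $\widehat f(n)=\int_{\mathbb{T}^2}f(x)e^{-2\pi i x\cdot n}\,dx$, $n\in\mathbb{Z}^2$. The hyperbolic Schrödinger propagator $e^{it\Box}$ is defined by $\widehat{e^{it\Box}f}(n)=e^{-2\pi i tH(n)}\widehat f(n)$, where $H(n)=n_1^2-n_2^2$ for $n=(n_1,n_2)\in\mathbb{Z}^2$. The projector $P_{\le N}$ is defined by $\widehat{P_{\le N}f}(n)=\mathbf{1}_{(-N,N]^2}(n)\,\widehat f(n)$. *)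

theory Defs
  imports "HOL-Analysis.Analysis"
begin

text \<open>
  The tori \<open>\<real>/\<int>\<close>, \<open>\<real>\<^sup>2/\<int>\<^sup>2\<close> and \<open>\<real>/\<int> \<times> \<real>\<^sup>2/\<int>\<^sup>2\<close> are represented, as measure spaces, by their half-open
  fundamental domains with Lebesgue measure; each has total mass one.
\<close>

abbreviation torus_time :: "real measure" where
  "torus_time \<equiv> lebesgue_on {0..<1}"

abbreviation torus2 :: "(real \<times> real) measure" where
  "torus2 \<equiv> lebesgue_on ({0..<1} \<times> {0..<1})"

abbreviation spacetime :: "(real \<times> real \<times> real) measure" where
  "spacetime \<equiv> lebesgue_on ({0..<1} \<times> {0..<1} \<times> {0..<1})"

text \<open>
  Complex \<open>L\<^sup>p\<close> functions (individual functions, not classes modulo null sets) for \<open>0 < p < \<infinity>\<close>.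
  The value of \<open>Lp_norm\<close> is meaningful only on \<open>Lp_fun\<close>, because the Bochner integral of a
  non-integrable function is \<open>0\<close>.
\<close>

definition Lp_fun :: "real \<Rightarrow> 'a measure \<Rightarrow> ('a \<Rightarrow> complex) set" where
  "Lp_fun p M = {f \<in> borel_measurable M. integrable M (\<lambda>x. norm (f x) powr p)}"

definition Lp_norm :: "real \<Rightarrow> 'a measure \<Rightarrow> ('a \<Rightarrow> complex) \<Rightarrow> real" where
  "Lp_norm p M f = (LINT x|M. norm (f x) powr p) powr (1 / p)"

definition freq_dot :: "real \<times> real \<Rightarrow> int \<times> int \<Rightarrow> real" where
  "freq_dot x n = fst x * of_int (fst n) + snd x * of_int (snd n)"

definition fourier_coeff :: "(real \<times> real \<Rightarrow> complex) \<Rightarrow> int \<times> int \<Rightarrow> complex" where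
  "fourier_coeff f n = (LINT x|torus2. f x * exp (- 2 * of_real pi * \<i> * of_real (freq_dot x n)))"

definition hyp_symbol :: "int \<times> int \<Rightarrow> int" where
  "hyp_symbol n = (fst n)\<^sup>2 - (snd n)\<^sup>2"

definition freq_box :: "real \<Rightarrow> (int \<times> int) set" where
  "freq_box N = {n. - N < of_int (fst n) \<and> of_int (fst n) \<le> N \<and>
                    - N < of_int (snd n) \<and> of_int (snd n) \<le> N}"

text \<open>
  The operators are specified by Fourier coefficients, so their values are classes modulo null
  sets; each is given as the set of all its \<open>L\<^sup>2\<close> representatives.
\<close>

definition proj_le :: "real \<Rightarrow> (real \<times> real \<Rightarrow> complex) \<Rightarrow> (real \<times> real \<Rightarrow> complex) set" where
  "proj_le N f = {g \<in> Lp_fun 2 torus2.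
     \<forall>n. fourier_coeff g n = indicator (freq_box N) n * fourier_coeff f n}"

definition hyp_propagator :: "real \<Rightarrow> (real \<times> real \<Rightarrow> complex) \<Rightarrow> (real \<times> real \<Rightarrow> complex) set" where
  "hyp_propagator t f = {g \<in> Lp_fun 2 torus2.
     \<forall>n. fourier_coeff g n =
         exp (- 2 * of_real pi * \<i> * of_real t * of_int (hyp_symbol n)) * fourier_coeff f n}"

text \<open>
  The space-time function \<open>(t, x) \<mapsto> (e\<^sup>i\<^sup>t\<^sup>\<box> f)(x)\<close>. Joint measurability has to be required, since
  the representatives of the time slices could otherwise be chosen independently of each other.
\<close>

definition hyp_evolution :: "(real \<times> real \<Rightarrow> complex) \<Rightarrow> (real \<times> real \<times> real \<Rightarrow> complex) set" where
  "hyp_evolution f = {u \<in> borel_measurable spacetime.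
     AE t in torus_time. (\<lambda>x. u (t, x)) \<in> hyp_propagator t f}"


subsection \<open>Existence of the representatives for band-limited functions\<close>

definition trig_poly :: "(int \<times> int) set \<Rightarrow> (int \<times> int \<Rightarrow> complex) \<Rightarrow> real \<times> real \<Rightarrow> complex" where
  "trig_poly A c x = (\<Sum>n\<in>A. c n * exp (2 * of_real pi * \<i> * of_real (freq_dot x n)))"

lemma finite_freq_box: "finite (freq_box N)"
proof -
  have "freq_box N \<subseteq> {-\<lceil>N\<rceil>..\<lceil>N\<rceil>} \<times> {-\<lceil>N\<rceil>..\<lceil>N\<rceil>}"
    by (auto simp: freq_box_def) linarith+
  then show ?thesis
    by (rule finite_subset) auto
qed

lemma integral_exp_unit_interval:
  "(LINT x|lborel. indicator {0..<1} x *\<^sub>R exp (2 * of_real pi * \<i> * of_real (x * of_int k)))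
     = (if k = 0 then 1 else 0 :: complex)"
proof -
  let ?f = "\<lambda>x::real. exp (2 * of_real pi * \<i> * of_real (x * of_int k))"
  have AE_eq: "AE x in lborel. indicator {0..<1::real} x *\<^sub>R ?f x = indicator {0..1} x *\<^sub>R ?f x"
    using AE_lborel_singleton[of "1::real"] by eventually_elim (auto simp: indicator_def)
  have 1: "(LINT x|lborel. indicator {0..<1} x *\<^sub>R ?f x) = (LINT x|lborel. indicator {0..1} x *\<^sub>R ?f x)"
    by (rule integral_cong_AE[OF _ _ AE_eq]) measurable
  show ?thesis
  proof (cases "k = 0")
    case True
    then show ?thesis unfolding 1 by (simp add: scaleR_conv_of_real)
  next
    case False
    let ?c = "2 * of_real pi * \<i> * of_int k :: complex"
    have c: "?c \<noteq> 0" using False by simp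
    have "(LINT x|lborel. indicator {0..1} x *\<^sub>R ?f x) = exp (?c * of_real 1) / ?c - exp (?c * of_real 0) / ?c"
    proof (rule integral_FTC_Icc)
      fix x :: real
      have "((\<lambda>z. exp (?c * z) / ?c) has_field_derivative exp (?c * of_real x)) (at (of_real x))"
        using c by (auto intro!: derivative_eq_intros)
      from has_vector_derivative_real_field[OF this, of UNIV]
      have "((\<lambda>x. exp (?c * of_real x) / ?c) has_vector_derivative exp (?c * of_real x)) (at x within {0..1})"
        by (rule has_vector_derivative_within_subset) auto
      then show "((\<lambda>x. exp (?c * of_real x) / ?c) has_vector_derivative ?f x) (at x within {0..1})"
        by (simp add: mult_ac)
    qed (auto intro!: continuous_intros)
    also have "\<dots> = 0"
      by (simp add: exp_eq_1)
    finally show ?thesis unfolding 1 using False by simp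
  qed
qed

lemma integral_exp_torus2:
  "(LINT x|torus2. exp (2 * of_real pi * \<i> * of_real (freq_dot x n))) = (if n = (0, 0) then 1 else 0)"
proof -
  let ?e = "\<lambda>k x. indicator {0..<1} x *\<^sub>R exp (2 * of_real pi * \<i> * of_real (x * of_int k)) :: complex"
  let ?F = "\<lambda>x. indicator ({0..<1::real} \<times> {0..<1::real}) x *\<^sub>R exp (2 * of_real pi * \<i> * of_real (freq_dot x n)) :: complex"
  have S: "{0..<1::real} \<times> {0..<1::real} \<in> sets borel"
    by (simp add: borel_prod[symmetric])
  have F: "?F = (\<lambda>(x, y). ?e (fst n) x * ?e (snd n) y)"
    by (auto simp: fun_eq_iff freq_dot_def indicator_def exp_add[symmetric] algebra_simps)
  have m: "?F \<in> borel_measurable borel"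
    unfolding F by (simp add: borel_prod[symmetric])
  have int: "integrable lborel ?F"
  proof (rule Bochner_Integration.integrable_bound[of lborel "indicator ({0..<1::real} \<times> {0..<1::real}) :: _ \<Rightarrow> real"])
    have "emeasure lborel ({0..<1::real} \<times> {0..<1::real}) \<le> emeasure lborel (cbox (0, 0) (1 :: real, 1 :: real))"
      by (rule emeasure_mono) (auto simp: cbox_Pair_eq borel_prod[symmetric])
    also have "\<dots> < \<infinity>"
      using emeasure_lborel_cbox_finite by auto
    finally show "integrable lborel (indicator ({0..<1::real} \<times> {0..<1::real}) :: _ \<Rightarrow> real)"
      using S by (intro integrable_real_indicator) auto
    show "?F \<in> borel_measurable lborel" using m by simp
  qed (auto simp: indicator_def norm_exp_eq_Re)
  have "(LINT x|torus2. exp (2 * of_real pi * \<i> * of_real (freq_dot x n))) = integral\<^sup>L lebesgue ?F"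
    using S by (intro integral_restrict_space) auto
  also have "\<dots> = integral\<^sup>L lborel ?F"
    using m by (intro integral_completion) simp
  also have "\<dots> = integral\<^sup>L (lborel \<Otimes>\<^sub>M lborel) (\<lambda>(x, y). ?e (fst n) x * ?e (snd n) y)"
    unfolding F lborel_prod ..
  also have "\<dots> = (LINT x|lborel. LINT y|lborel. ?e (fst n) x * ?e (snd n) y)"
    using lborel_pair.integral_fst'[of "\<lambda>(x, y). ?e (fst n) x * ?e (snd n) y"] int
    unfolding F lborel_prod by simp
  also have "\<dots> = (LINT x|lborel. ?e (fst n) x * (LINT y|lborel. ?e (snd n) y))"
    by (simp only: integral_mult_right_zero)
  also have "\<dots> = (LINT x|lborel. ?e (fst n) x) * (LINT y|lborel. ?e (snd n) y)"
    by (rule integral_mult_left_zero)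
  finally show ?thesis
    unfolding integral_exp_unit_interval by (cases n) auto
qed

lemma continuous_integrable_torus2:
  fixes f :: "real \<times> real \<Rightarrow> 'b::euclidean_space"
  assumes "continuous_on UNIV f"
  shows "integrable torus2 f"
proof -
  have "integrable (lebesgue_on (cbox (0, 0) (1, 1))) f"
    by (rule continuous_imp_integrable) (rule continuous_on_subset[OF assms], simp)
  then have "set_integrable lebesgue (cbox (0, 0) (1, 1)) f"
    unfolding set_integrable_def by (subst (asm) integrable_restrict_space) auto
  then have "set_integrable lebesgue ({0..<1} \<times> {0..<1}) f"
    by (rule set_integrable_subset) (auto simp: cbox_Pair_eq borel_prod[symmetric])
  then show ?thesis
    unfolding set_integrable_def
    by (subst integrable_restrict_space) (auto simp: borel_prod[symmetric])
qed

lemma trig_poly_Lp: "trig_poly A c \<in> Lp_fun 2 torus2"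
proof -
  have cont: "continuous_on UNIV (trig_poly A c)"
    unfolding trig_poly_def freq_dot_def by (intro continuous_intros)
  have "integrable torus2 (\<lambda>x. norm (trig_poly A c x) powr 2)"
    by (rule continuous_integrable_torus2) (intro continuous_on_powr' continuous_on_norm cont continuous_on_const, auto)
  moreover have "trig_poly A c \<in> borel_measurable torus2"
    using continuous_integrable_torus2[OF cont] by (rule borel_measurable_integrable)
  ultimately show ?thesis by (simp add: Lp_fun_def)
qed

lemma fourier_coeff_trig_poly:
  assumes "finite A"
  shows "fourier_coeff (trig_poly A c) n = (if n \<in> A then c n else 0)"
proof -
  let ?E = "\<lambda>m x. exp (2 * of_real pi * \<i> * of_real (freq_dot x m)) :: complex"
  have eq: "trig_poly A c x * exp (- 2 * of_real pi * \<i> * of_real (freq_dot x n))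
      = (\<Sum>m\<in>A. c m * ?E (m - n) x)" for x
    by (simp add: trig_poly_def sum_distrib_right mult.assoc exp_add[symmetric])
       (intro sum.cong refl, simp add: freq_dot_def algebra_simps)
  have int: "integrable torus2 (\<lambda>x. c m * ?E (m - n) x)" for m
    unfolding freq_dot_def by (intro continuous_integrable_torus2 continuous_intros)
  have "fourier_coeff (trig_poly A c) n = (\<Sum>m\<in>A. LINT x|torus2. c m * ?E (m - n) x)"
    unfolding fourier_coeff_def eq by (rule Bochner_Integration.integral_sum) (rule int)
  also have "\<dots> = (\<Sum>m\<in>A. if m = n then c m else 0)"
    by (intro sum.cong refl) (auto simp: integral_exp_torus2 zero_prod_def[symmetric])
  finally show ?thesis using assms by simp
qed

lemma proj_le_nonempty: "proj_le N f \<noteq> {}"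
proof -
  have "trig_poly (freq_box N) (fourier_coeff f) \<in> proj_le N f"
    by (auto simp: proj_le_def trig_poly_Lp fourier_coeff_trig_poly finite_freq_box)
  then show ?thesis by blast
qed

lemma hyp_evolution_proj_le_nonempty:
  assumes "g \<in> proj_le N f"
  shows "hyp_evolution g \<noteq> {}"
proof -
  let ?c = "\<lambda>t n. exp (- 2 * of_real pi * \<i> * of_real t * of_int (hyp_symbol n)) * fourier_coeff g n"
  let ?u = "\<lambda>p. trig_poly (freq_box N) (?c (fst p)) (snd p)"
  have out: "fourier_coeff g n = 0" if "n \<notin> freq_box N" for n
    using assms that by (cases n) (simp add: proj_le_def)
  have "continuous_on UNIV ?u"
    unfolding trig_poly_def freq_dot_def by (intro continuous_intros)
  then have "?u \<in> borel_measurable borel"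
    by (rule borel_measurable_continuous_onI)
  then have "?u \<in> borel_measurable lebesgue"
    by (simp add: measurable_completion)
  then have "?u \<in> borel_measurable spacetime"
    by (rule measurable_restrict_space1)
  moreover have "(\<lambda>x. ?u (t, x)) \<in> hyp_propagator t g" for t
    by (auto simp: hyp_propagator_def trig_poly_Lp fourier_coeff_trig_poly finite_freq_box out)
  ultimately have "?u \<in> hyp_evolution g"
    by (simp add: hyp_evolution_def)
  then show ?thesis by blast
qed

end

theory Submission
  imports Defs
begin

text \<open>
  By uniqueness of Fourier coefficients, every representative of the evolution of the projected
  function is almost everywhere equal to the exponential sum
  \<open>U(t, x) = \<Sum>n. c n * exp (2\<pi>\<i> (x \<cdot> n - t H(n)))\<close> over the box \<open>(-N, N]\<^sup>2\<close>, where \<open>c n\<close> are the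
  Fourier coefficients of \<open>f\<close> (\<open>fourier_coeff_zero_imp_AE_zero\<close>, \<open>hyp_evolution_AE_eq\<close>).

  Since the exponent is even, the \<open>L\<^sup>4\<close> norm of \<open>U\<close> is computed from the \<open>L\<^sup>2\<close> norm of \<open>U\<^sup>2\<close>. The
  coefficient of \<open>U\<^sup>2\<close> at the space-time frequency \<open>(m, h)\<close> is the sum of \<open>c p * c q\<close> over the pairs
  in the box with \<open>p + q = m\<close> and \<open>H(p) + H(q) = h\<close>. Orthogonality of the space-time characters and
  Cauchy--Schwarz bound the integral of \<open>|U|\<^sup>4\<close> by the largest number of such pairs times the square
  of \<open>\<Sum>n. |c n|\<^sup>2\<close>, which is at most the square of the energy of \<open>f\<close> by Bessel's inequality.

  The number of pairs is \<open>O(N)\<close> for an elementary reason: once the first coordinate of \<open>p\<close> is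
  chosen, the second one solves a quadratic equation (\<open>card_resonance_le\<close>). Null directions of the
  form \<open>H\<close> do produce that many pairs, so no arithmetic input such as the divisor bound could improve
  the count, and the elementary bound loses no power of \<open>N\<close>. Taking fourth roots gives the factor
  \<open>N\<close> to the power \<open>1/4\<close>.
\<close>

section \<open>Trigonometric polynomials are uniformly dense\<close>

definition trigonometric :: "(real \<times> real \<Rightarrow> complex) \<Rightarrow> bool" where
  "trigonometric \<psi> \<longleftrightarrow> (\<exists>A c. finite A \<and> \<psi> = trig_poly A c)"

lemma continuous_trig_poly: "continuous_on S (trig_poly A c)"
  unfolding trig_poly_def freq_dot_def by (intro continuous_intros)

lemma trigonometric_monomial:
  "trigonometric (\<lambda>x. c * exp (2 * of_real pi * \<i> * of_real (freq_dot x n)))"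
  unfolding trigonometric_def
  by (intro exI[of _ "{n}"] exI[of _ "\<lambda>_. c"]) (simp add: trig_poly_def fun_eq_iff)

lemma trigonometric_const: "trigonometric (\<lambda>x. c)"
  using trigonometric_monomial[of c "(0, 0)"] by (simp add: freq_dot_def)

lemma trigonometric_add:
  assumes "trigonometric f" "trigonometric g"
  shows "trigonometric (\<lambda>x. f x + g x)"
proof -
  obtain A c B d where *: "finite A" "f = trig_poly A c" "finite B" "g = trig_poly B d"
    using assms unfolding trigonometric_def by blast
  let ?e = "\<lambda>n. (if n \<in> A then c n else 0) + (if n \<in> B then d n else 0)"
  have "trig_poly A c x + trig_poly B d x = trig_poly (A \<union> B) ?e x" for x
  proof -
    have A: "trig_poly A c x = (\<Sum>n\<in>A \<union> B. (if n \<in> A then c n else 0) * exp (2 * of_real pi * \<i> * of_real (freq_dot x n)))"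
      unfolding trig_poly_def using * by (intro sum.mono_neutral_cong_left) auto
    have B: "trig_poly B d x = (\<Sum>n\<in>A \<union> B. (if n \<in> B then d n else 0) * exp (2 * of_real pi * \<i> * of_real (freq_dot x n)))"
      unfolding trig_poly_def using * by (intro sum.mono_neutral_cong_left) auto
    show ?thesis unfolding A B by (simp add: trig_poly_def ring_distribs sum.distrib)
  qed
  then show ?thesis
    unfolding trigonometric_def using * by (intro exI[of _ "A \<union> B"] exI[of _ ?e]) auto
qed

lemma trigonometric_sum:
  assumes "\<And>i. i \<in> I \<Longrightarrow> trigonometric (f i)"
  shows "trigonometric (\<lambda>x. \<Sum>i\<in>I. f i x)"
  using assms
proof (induction I rule: infinite_finite_induct)
  case (insert i I)
  then show ?case by (simp add: trigonometric_add)
qed (simp_all add: trigonometric_const)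

lemma trigonometric_mult:
  assumes "trigonometric f" "trigonometric g"
  shows "trigonometric (\<lambda>x. f x * g x)"
proof -
  obtain A c B d where *: "f = trig_poly A c" "g = trig_poly B d"
    using assms unfolding trigonometric_def by blast
  have "f x * g x = (\<Sum>a\<in>A. \<Sum>b\<in>B. c a * d b * exp (2 * of_real pi * \<i> * of_real (freq_dot x (a + b))))" for x
    unfolding * trig_poly_def sum_product
    by (intro sum.cong refl) (simp add: freq_dot_def ring_distribs exp_add)
  then show ?thesis
    by (simp add: trigonometric_sum trigonometric_monomial)
qed

lemma trigonometric_cos:
  "trigonometric (\<lambda>x. of_real (cos (2 * pi * freq_dot x n)))"
proof -
  have "(\<lambda>x. complex_of_real (cos (2 * pi * freq_dot x n)))
    = (\<lambda>x. (1/2) * exp (2 * of_real pi * \<i> * of_real (freq_dot x n)) + (1/2) * exp (2 * of_real pi * \<i> * of_real (freq_dot x (-n))))"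
    by (simp add: fun_eq_iff cos_of_real[symmetric] cos_exp_eq freq_dot_def field_simps)
  then show ?thesis by (simp only: trigonometric_add trigonometric_monomial)
qed

lemma trigonometric_sin:
  "trigonometric (\<lambda>x. of_real (sin (2 * pi * freq_dot x n)))"
proof -
  have "(\<lambda>x. complex_of_real (sin (2 * pi * freq_dot x n)))
    = (\<lambda>x. (1/(2*\<i>)) * exp (2 * of_real pi * \<i> * of_real (freq_dot x n)) + (-1/(2*\<i>)) * exp (2 * of_real pi * \<i> * of_real (freq_dot x (-n))))"
    by (simp add: fun_eq_iff sin_of_real[symmetric] sin_exp_eq freq_dot_def field_simps)
  then show ?thesis by (simp only: trigonometric_add trigonometric_monomial)
qed

text \<open>
  The torus as a compact subset of the Euclidean space \<open>\<complex>\<^sup>2\<close>, where the Stone--Weierstrass theorem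
  provides approximation by real polynomials in the coordinates; on this subset the coordinates
  are sines and cosines.
\<close>

definition torus_embed :: "real \<times> real \<Rightarrow> complex \<times> complex" where
  "torus_embed x = (cis (2 * pi * fst x), cis (2 * pi * snd x))"

lemma trigonometric_real_polynomial:
  assumes "real_polynomial_function p"
  shows "trigonometric (\<lambda>x. of_real (p (torus_embed x)))"
  using assms
proof (induction rule: real_polynomial_function.induct)
  case (linear p)
  then interpret bounded_linear p .
  have lin: "p (z, w) = Re z * p (1, 0) + Im z * p (\<i>, 0) + Re w * p (0, 1) + Im w * p (0, \<i>)" for z w
  proof -
    have "(z, w) = Re z *\<^sub>R (1, 0) + Im z *\<^sub>R (\<i>, 0) + Re w *\<^sub>R (0, 1) + Im w *\<^sub>R (0, \<i>)"
      by (simp add: complex_eq_iff)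
    then show ?thesis by (simp only: add scale real_scaleR_def)
  qed
  have eq: "of_real (p (torus_embed x)) =
      of_real (cos (2 * pi * freq_dot x (1, 0))) * complex_of_real (p (1, 0))
    + of_real (sin (2 * pi * freq_dot x (1, 0))) * complex_of_real (p (\<i>, 0))
    + of_real (cos (2 * pi * freq_dot x (0, 1))) * complex_of_real (p (0, 1))
    + of_real (sin (2 * pi * freq_dot x (0, 1))) * complex_of_real (p (0, \<i>))" for x
    unfolding torus_embed_def
    by (subst lin) (simp add: freq_dot_def)
  show ?case unfolding eq
    by (intro trigonometric_add trigonometric_mult trigonometric_const trigonometric_cos trigonometric_sin)
qed (simp_all add: trigonometric_const trigonometric_add trigonometric_mult)

text \<open>
  Vanishing off the open square makes \<open>\<phi>\<close> agree on opposite edges of the closed square. Since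
  \<^const>\<open>torus_embed\<close> maps the closed square onto the torus as a quotient map, \<open>\<phi>\<close> descends to a
  continuous function on the torus, and a polynomial close to that function pulls back to a
  trigonometric polynomial.
\<close>

lemma trigonometric_approximation:
  fixes \<phi> :: "real \<times> real \<Rightarrow> complex"
  assumes cont: "continuous_on UNIV \<phi>"
    and vanish: "\<And>x. x \<notin> {0<..<1} \<times> {0<..<1} \<Longrightarrow> \<phi> x = 0"
    and e: "e > 0"
  obtains \<psi> where "trigonometric \<psi>" "\<And>x. x \<in> {0..1} \<times> {0..1} \<Longrightarrow> norm (\<phi> x - \<psi> x) < e"
proof -
  let ?Q = "{0..1::real} \<times> {0..1::real}"
  let ?T = "torus_embed ` ?Q"
  have cQ: "compact ?Q" by (intro compact_Times) auto
  have cE: "continuous_on ?Q torus_embed"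
    unfolding torus_embed_def by (intro continuous_intros)
  have quot: "quotient_map (top_of_set ?Q) (top_of_set ?T) torus_embed"
    using cE cQ by (intro continuous_imp_quotient_map) (auto simp: compact_space_subtopology Hausdorff_space_subtopology)
  have fib: "\<phi> x = \<phi> y" if "x \<in> ?Q" "y \<in> ?Q" "torus_embed x = torus_embed y" for x y
  proof (cases "x = y")
    case False
    have *: "s = t \<or> (s = 0 \<and> t = 1) \<or> (s = 1 \<and> t = 0)"
      if "cis (2 * pi * s) = cis (2 * pi * t)" "s \<in> {0..1}" "t \<in> {0..1}" for s t :: real
    proof -
      obtain n :: int where "\<i> * complex_of_real (2 * pi * s) = \<i> * complex_of_real (2 * pi * t) + (of_int (2 * n) * pi) * \<i>"
        using \<open>cis _ = _\<close> unfolding cis_conv_exp exp_eq by blast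
      then have "\<i> * complex_of_real (2 * pi * s) = \<i> * complex_of_real (2 * pi * t + of_int (2 * n) * pi)"
        by (simp add: algebra_simps)
      then have "2 * pi * s = 2 * pi * t + of_int (2 * n) * pi"
        using mult_left_cancel[OF complex_i_not_zero] of_real_eq_iff by blast
      then have "(2 * pi) * s = (2 * pi) * (t + of_int n)" by (simp add: algebra_simps)
      then have st: "s = t + of_int n" by simp
      then have "-1 \<le> real_of_int n" "real_of_int n \<le> 1" using that(2,3) by auto
      then have "n = -1 \<or> n = 0 \<or> n = 1" by linarith
      then show ?thesis using st that(2,3) by auto
    qed
    have "fst x = fst y \<or> (fst x = 0 \<and> fst y = 1) \<or> (fst x = 1 \<and> fst y = 0)"
      "snd x = snd y \<or> (snd x = 0 \<and> snd y = 1) \<or> (snd x = 1 \<and> snd y = 0)"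
      using that by (intro *; auto simp: torus_embed_def)+
    with False have "x \<notin> {0<..<1} \<times> {0<..<1}" "y \<notin> {0<..<1} \<times> {0<..<1}"
      by (auto simp: prod_eq_iff)
    then show ?thesis by (simp add: vanish)
  qed simp
  have cm: "continuous_map (top_of_set ?Q) euclidean \<phi>"
    using continuous_on_subset[OF cont] by simp
  have "\<exists>\<Phi>. continuous_map (top_of_set ?T) euclidean \<Phi> \<and> (\<forall>x\<in>?Q. \<Phi> (torus_embed x) = \<phi> x)"
  proof (rule quotient_map_lift_exists[OF quot cm])
    fix x y assume "x \<in> topspace (top_of_set ?Q)" "y \<in> topspace (top_of_set ?Q)" "torus_embed x = torus_embed y"
    then show "\<phi> x = \<phi> y" by (intro fib) simp_all
  next
    fix \<Phi> assume \<Phi>: "continuous_map (top_of_set ?T) euclidean \<Phi>"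
      "\<And>x. x \<in> topspace (top_of_set ?Q) \<Longrightarrow> \<Phi> (torus_embed x) = \<phi> x"
    have "\<Phi> (torus_embed x) = \<phi> x" if "x \<in> ?Q" for x
      using that by (intro \<Phi>(2)) simp
    with \<Phi>(1) show ?thesis by blast
  qed
  then obtain \<Phi> where \<Phi>: "continuous_map (top_of_set ?T) euclidean \<Phi>" "\<And>x. x \<in> ?Q \<Longrightarrow> \<Phi> (torus_embed x) = \<phi> x"
    by blast
  have "compact ?T" by (rule compact_continuous_image[OF cE cQ])
  moreover have "continuous_on ?T \<Phi>" using \<Phi>(1) by simp
  ultimately have "\<exists>P. polynomial_function P \<and> (\<forall>z\<in>?T. norm (\<Phi> z - P z) < e)"
    using e by (rule Stone_Weierstrass_polynomial_function)
  then obtain P where P: "polynomial_function P" "\<forall>z\<in>?T. norm (\<Phi> z - P z) < e"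
    by blast
  have re: "real_polynomial_function (\<lambda>z. Re (P z))" "real_polynomial_function (\<lambda>z. Im (P z))"
    using P(1)[unfolded polynomial_function_def o_def, rule_format, OF bounded_linear_Re]
      P(1)[unfolded polynomial_function_def o_def, rule_format, OF bounded_linear_Im] .
  have "trigonometric (\<lambda>x. of_real (Re (P (torus_embed x))) + \<i> * of_real (Im (P (torus_embed x))))"
    by (intro trigonometric_add trigonometric_mult trigonometric_const trigonometric_real_polynomial re)
  then have "trigonometric (\<lambda>x. P (torus_embed x))"
    by (simp add: complex_eq[symmetric])
  moreover have "norm (\<phi> x - P (torus_embed x)) < e" if "x \<in> ?Q" for x
    using bspec[OF P(2) imageI[OF that]] unfolding \<Phi>(2)[OF that] .
  ultimately show ?thesis by (intro that)
qed

section \<open>Uniqueness of Fourier coefficients\<close>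

lemma integrable_mult_bounded:
  fixes f h :: "'a \<Rightarrow> complex"
  assumes "integrable M f" "h \<in> borel_measurable M" "\<And>x. x \<in> space M \<Longrightarrow> norm (h x) \<le> B"
  shows "integrable M (\<lambda>x. f x * h x)"
proof (rule Bochner_Integration.integrable_bound)
  show "integrable M (\<lambda>x. B * norm (f x))" using assms(1) by simp
  show "(\<lambda>x. f x * h x) \<in> borel_measurable M" using assms by simp
  show "AE x in M. norm (f x * h x) \<le> norm (B * norm (f x))"
  proof (rule AE_I2)
    fix x assume "x \<in> space M"
    then have "norm (h x) * norm (f x) \<le> \<bar>B\<bar> * norm (f x)"
      using assms(3)[of x] by (intro mult_right_mono) auto
    then show "norm (f x * h x) \<le> norm (B * norm (f x))"
      by (simp add: norm_mult abs_mult mult.commute)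
  qed
qed

lemma space_torus2: "space torus2 = {0..<1} \<times> {0..<1}"
  by (simp add: space_restrict_space)

lemma sets_unit_square: "{0..<1::real} \<times> {0..<1::real} \<in> sets lebesgue"
  by (intro sets_completionI_sets) (simp add: borel_prod[symmetric])

lemma continuous_bounded_torus2:
  fixes h :: "real \<times> real \<Rightarrow> complex"
  assumes "continuous_on UNIV h"
  obtains B where "\<And>x. x \<in> {0..1} \<times> {0..1} \<Longrightarrow> norm (h x) \<le> B"
proof -
  have "compact (h ` ({0..1} \<times> {0..1}))"
    by (intro compact_continuous_image compact_Times continuous_on_subset[OF assms]) auto
  then have "bounded (h ` ({0..1} \<times> {0..1}))" by (rule compact_imp_bounded)
  then show ?thesis using that unfolding bounded_iff by blast
qed

lemma integrable_mult_continuous_torus2: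
  fixes f h :: "real \<times> real \<Rightarrow> complex"
  assumes "integrable torus2 f" "continuous_on UNIV h"
  shows "integrable torus2 (\<lambda>x. f x * h x)"
proof -
  obtain B where "\<And>x. x \<in> {0..1} \<times> {0..1} \<Longrightarrow> norm (h x) \<le> B"
    using continuous_bounded_torus2[OF assms(2)] by blast
  moreover have "h \<in> borel_measurable torus2"
    using continuous_integrable_torus2[OF assms(2)] by (rule borel_measurable_integrable)
  ultimately show ?thesis
    using assms(1) by (intro integrable_mult_bounded[where B=B]) (auto simp: space_torus2)
qed

lemma integral_mult_cnj_trig_poly:
  assumes "integrable torus2 g"
  shows "(LINT x|torus2. g x * cnj (trig_poly A c x)) = (\<Sum>n\<in>A. cnj (c n) * fourier_coeff g n)"
proof -
  let ?E = "\<lambda>n x. exp (- 2 * of_real pi * \<i> * of_real (freq_dot x n)) :: complex"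
  have "g x * cnj (trig_poly A c x) = (\<Sum>n\<in>A. cnj (c n) * (g x * ?E n x))" for x
    by (simp add: trig_poly_def exp_cnj sum_distrib_left mult_ac)
  then have "(LINT x|torus2. g x * cnj (trig_poly A c x)) = (LINT x|torus2. (\<Sum>n\<in>A. cnj (c n) * (g x * ?E n x)))"
    by simp
  also have "\<dots> = (\<Sum>n\<in>A. LINT x|torus2. cnj (c n) * (g x * ?E n x))"
    by (intro Bochner_Integration.integral_sum integrable_mult_right integrable_mult_continuous_torus2 assms)
       (auto simp: freq_dot_def intro!: continuous_intros)
  finally show ?thesis by (simp add: fourier_coeff_def)
qed

text \<open>
  The pairing with \<open>\<phi>\<close> equals the pairing with \<open>\<phi> - \<psi>\<close> for every trigonometric polynomial \<open>\<psi>\<close>,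
  and the latter is at most the \<open>L\<^sup>1\<close> norm of \<open>g\<close> times the uniform norm of \<open>\<phi> - \<psi>\<close>.
\<close>

lemma orthogonal_to_continuous:
  fixes \<phi> :: "real \<times> real \<Rightarrow> complex"
  assumes g: "integrable torus2 g" and zero: "\<And>n. fourier_coeff g n = 0"
    and cont: "continuous_on UNIV \<phi>"
    and vanish: "\<And>x. x \<notin> {0<..<1} \<times> {0<..<1} \<Longrightarrow> \<phi> x = 0"
  shows "(LINT x|torus2. g x * cnj (\<phi> x)) = 0"
proof -
  define I where "I = (LINT x|torus2. norm (g x))"
  have bound: "norm (LINT x|torus2. g x * cnj (\<phi> x)) \<le> e * I" if e: "e > 0" for e
  proof -
    obtain \<psi> where \<psi>: "trigonometric \<psi>" "\<And>x. x \<in> {0..1} \<times> {0..1} \<Longrightarrow> norm (\<phi> x - \<psi> x) < e"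
      using trigonometric_approximation[OF cont vanish e] by blast
    then obtain A c where \<psi>_eq: "\<psi> = trig_poly A c" unfolding trigonometric_def by blast
    have int_\<phi>: "integrable torus2 (\<lambda>x. g x * cnj (\<phi> x))"
      by (intro integrable_mult_continuous_torus2 g continuous_intros cont)
    have int_\<psi>: "integrable torus2 (\<lambda>x. g x * cnj (\<psi> x))"
      unfolding \<psi>_eq by (intro integrable_mult_continuous_torus2 g continuous_on_cnj continuous_trig_poly)
    have "(LINT x|torus2. g x * cnj (\<psi> x)) = 0"
      unfolding \<psi>_eq by (simp add: integral_mult_cnj_trig_poly[OF g] zero)
    then have "(LINT x|torus2. g x * cnj (\<phi> x)) = (LINT x|torus2. g x * cnj (\<phi> x) - g x * cnj (\<psi> x))"
      using int_\<phi> int_\<psi> by simp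
    also have "norm \<dots> \<le> (LINT x|torus2. e * norm (g x))"
    proof (rule Bochner_Integration.integral_norm_bound_integral)
      show "integrable torus2 (\<lambda>x. g x * cnj (\<phi> x) - g x * cnj (\<psi> x))"
        using int_\<phi> int_\<psi> by simp
      show "integrable torus2 (\<lambda>x. e * norm (g x))" using g by simp
      fix x assume "x \<in> space torus2"
      then have "norm (\<phi> x - \<psi> x) \<le> e" by (intro less_imp_le \<psi>(2)) (auto simp: space_torus2)
      then have "norm (g x) * norm (cnj (\<phi> x - \<psi> x)) \<le> norm (g x) * e"
        by (intro mult_left_mono) (simp_all only: complex_mod_cnj norm_ge_zero)
      then show "norm (g x * cnj (\<phi> x) - g x * cnj (\<psi> x)) \<le> e * norm (g x)"
        by (simp add: norm_mult[symmetric] right_diff_distrib mult.commute[of _ e])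
    qed
    finally show ?thesis by (simp add: I_def)
  qed
  have "norm (LINT x|torus2. g x * cnj (\<phi> x)) \<le> 0"
  proof (rule field_le_epsilon)
    fix e :: real assume e: "e > 0"
    have I: "I \<ge> 0" by (simp add: I_def)
    have "e * (I / (I + 1)) \<le> e * 1" using e I by (intro mult_left_mono) auto
    moreover have "e / (I + 1) > 0" using e I by (simp add: add_nonneg_pos)
    ultimately show "norm (LINT x|torus2. g x * cnj (\<phi> x)) \<le> 0 + e"
      using bound[of "e / (I + 1)"] by simp
  qed
  then show ?thesis by simp
qed

lemma AE_torus2_interior: "AE x in torus2. x \<in> {0<..<1} \<times> {0<..<1}"
proof -
  have "AE x in lborel. x \<bullet> (1 :: real, 0 :: real) \<noteq> 0" "AE x in lborel. x \<bullet> (0 :: real, 1 :: real) \<noteq> 0"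
    by (rule AE_lborel_inner_neq, simp add: Basis_prod_def)+
  then have "AE x in lborel. x \<in> {0..<1} \<times> {0..<1} \<longrightarrow> x \<in> {0<..<1::real} \<times> {0<..<1::real}"
    by eventually_elim auto
  then show ?thesis
    using sets_unit_square by (subst AE_restrict_space_iff) (auto intro: AE_completion)
qed

text \<open>
  It suffices to show that the pairing of \<open>g\<close> with its own phase \<open>sgn g\<close>, which is the \<open>L\<^sup>1\<close> norm,
  vanishes. A measurable function is an almost everywhere limit of continuous functions; truncated
  to modulus at most one and cut off near the boundary of the square, these are orthogonal to \<open>g\<close>,
  and dominated convergence passes to the limit.
\<close>

theorem fourier_coeff_zero_imp_AE_zero:
  assumes g: "integrable torus2 g" and zero: "\<And>n. fourier_coeff g n = 0"
  shows "AE x in torus2. g x = 0"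
proof -
  have g_meas: "g \<in> borel_measurable torus2" using g by (rule borel_measurable_integrable)
  then have sgn_meas: "(\<lambda>x. sgn (g x)) \<in> borel_measurable torus2" by measurable
  then have "(\<lambda>x. sgn (g x)) measurable_on ({0..<1} \<times> {0..<1})"
    using measurable_on_iff_borel_measurable[OF sets_unit_square] by blast
  then obtain Z G where Z: "negligible Z" and G: "\<And>k. continuous_on UNIV (G k)"
    and lim: "\<And>x. x \<notin> Z \<Longrightarrow> (\<lambda>k. G k x) \<longlonglongrightarrow> (if x \<in> {0..<1} \<times> {0..<1} then sgn (g x) else 0)"
    unfolding measurable_on_def by blast
  \<comment> \<open>On the square, \<open>d\<close> is the distance to the boundary, so \<open>min 1 (k * d)\<close> is a cutoff that tends
     to one at every interior point.\<close>
  define d :: "real \<times> real \<Rightarrow> real"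
    where "d x = max 0 (min (min (fst x) (1 - fst x)) (min (snd x) (1 - snd x)))" for x
  define clamp :: "complex \<Rightarrow> complex" where "clamp z = z / of_real (max 1 (norm z))" for z
  define \<phi> where "\<phi> k x = of_real (min 1 (real k * d x)) * clamp (G k x)" for k x
  have clamp_cont: "continuous_on UNIV clamp"
    unfolding clamp_def by (intro continuous_intros) (auto simp: max_def)
  have clamp_le: "norm (clamp z) \<le> 1" for z
    by (auto simp: clamp_def norm_divide divide_simps max_def)
  have clamp_id: "clamp z = z" if "norm z \<le> 1" for z
    using that by (simp add: clamp_def max_def)
  have d_cont: "continuous_on UNIV d"
    unfolding d_def by (intro continuous_intros)
  have d_zero: "d x = 0" if "x \<notin> {0<..<1} \<times> {0<..<1}" for x
    using that by (cases x) (auto simp: d_def max_def min_def)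
  have d_pos: "d x > 0" if "x \<in> {0<..<1} \<times> {0<..<1}" for x
    using that by (cases x) (auto simp: d_def max_def min_def)
  have d_nonneg: "d x \<ge> 0" for x by (simp add: d_def)
  have \<phi>_cont: "continuous_on UNIV (\<phi> k)" for k
    unfolding \<phi>_def
    by (intro continuous_intros d_cont continuous_on_compose2[OF clamp_cont G]) auto
  have \<phi>_le: "norm (\<phi> k x) \<le> 1" for k x
    unfolding \<phi>_def norm_mult using d_nonneg[of x] clamp_le[of "G k x"]
    by (intro mult_le_one) auto
  have \<phi>_zero: "(LINT x|torus2. g x * cnj (\<phi> k x)) = 0" for k
    by (rule orthogonal_to_continuous[OF g zero \<phi>_cont]) (simp add: \<phi>_def d_zero)
  have AE_Z: "AE x in torus2. x \<notin> Z"
    using Z sets_unit_square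
    by (subst AE_restrict_space_iff) (auto simp: negligible_iff_null_sets intro: AE_mp[OF AE_not_in])
  have AE_lim: "AE x in torus2. (\<lambda>k. g x * cnj (\<phi> k x)) \<longlonglongrightarrow> g x * cnj (sgn (g x))"
    using AE_Z AE_torus2_interior
  proof eventually_elim
    case (elim x)
    have "(\<lambda>k. clamp (G k x)) \<longlonglongrightarrow> clamp (sgn (g x))"
      using lim[OF elim(1)] elim(2) clamp_cont
      by (intro isCont_tendsto_compose[where g=clamp]) (auto simp: continuous_on_eq_continuous_at)
    moreover have "clamp (sgn (g x)) = sgn (g x)"
      by (rule clamp_id) (simp add: norm_sgn)
    moreover have "(\<lambda>k. of_real (min 1 (real k * d x)) :: complex) \<longlonglongrightarrow> 1"
    proof (rule tendsto_eventually)
      obtain m :: nat where m: "1 < of_nat m * d x"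
        using ex_less_of_nat_mult[OF d_pos[OF elim(2)], of 1] by auto
      have "min 1 (real k * d x) = 1" if "k \<ge> m" for k
      proof -
        have "real m * d x \<le> real k * d x" using that d_nonneg by (intro mult_right_mono) auto
        then show ?thesis using m by simp
      qed
      then show "\<forall>\<^sub>F k in sequentially. (of_real (min 1 (real k * d x)) :: complex) = 1"
        by (auto simp: eventually_sequentially)
    qed
    ultimately have "(\<lambda>k. \<phi> k x) \<longlonglongrightarrow> 1 * sgn (g x)"
      unfolding \<phi>_def by (intro tendsto_mult) auto
    then show ?case by (intro tendsto_intros) simp
  qed
  have "(\<lambda>k. LINT x|torus2. g x * cnj (\<phi> k x)) \<longlonglongrightarrow> (LINT x|torus2. g x * cnj (sgn (g x)))"
  proof (rule integral_dominated_convergence[where w="\<lambda>x. norm (g x)"])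
    show "(\<lambda>x. g x * cnj (sgn (g x))) \<in> borel_measurable torus2"
      by (intro borel_measurable_times g_meas continuous_intros
            measurable_compose[OF sgn_meas borel_measurable_continuous_onI[of cnj]])
    show "(\<lambda>x. g x * cnj (\<phi> k x)) \<in> borel_measurable torus2" for k
      by (intro borel_measurable_integrable integrable_mult_continuous_torus2 g continuous_intros \<phi>_cont)
    show "integrable torus2 (\<lambda>x. norm (g x))" using g by simp
    show "AE x in torus2. norm (g x * cnj (\<phi> k x)) \<le> norm (g x)" for k
      using \<phi>_le[of k] by (intro AE_I2) (simp add: norm_mult mult_left_le)
  qed (fact AE_lim)
  then have "(LINT x|torus2. g x * cnj (sgn (g x))) = 0"
    by (simp add: \<phi>_zero LIMSEQ_const_iff)
  moreover have "g x * cnj (sgn (g x)) = of_real (norm (g x))" for x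
  proof -
    have "g x * cnj (sgn (g x)) = (g x * cnj (g x)) / of_real (norm (g x))"
      by (simp add: sgn_div_norm scaleR_conv_of_real divide_inverse mult_ac)
    also have "\<dots> = of_real (norm (g x))"
      by (simp add: complex_norm_square[symmetric] power2_eq_square)
    finally show ?thesis .
  qed
  ultimately have "(LINT x|torus2. norm (g x)) = 0" by simp
  then have "AE x in torus2. norm (g x) = 0"
    using g by (subst (asm) integral_nonneg_eq_0_iff_AE) auto
  then show ?thesis by simp
qed

section \<open>Passing from time slices to space-time\<close>

text \<open>
  Tonelli's theorem is available for the product of Borel measures, whereas the exceptional set is
  only Lebesgue measurable. Almost all slices of its Borel part \<open>S\<close> are null, being contained
  in the slices of that set, and the rest is null by the definition of the completion.
\<close>

lemma AE_spacetime_of_slices: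
  fixes u v :: "real \<times> real \<times> real \<Rightarrow> complex"
  assumes meas: "u \<in> borel_measurable spacetime" "v \<in> borel_measurable spacetime"
    and slices: "AE t in torus_time. AE x in torus2. u (t, x) = v (t, x)"
  shows "AE z in spacetime. u z = v z"
proof -
  let ?Q = "{0..<1::real} \<times> {0..<1::real} \<times> {0..<1::real}"
  let ?A = "{z \<in> ?Q. u z \<noteq> v z}"
  have Q: "?Q \<in> sets lebesgue"
    by (intro sets_completionI_sets) (simp add: borel_prod[symmetric])
  have "(\<lambda>z. u z - v z) -` (- {0}) \<inter> space spacetime \<in> sets spacetime"
    by (rule measurable_sets[OF borel_measurable_diff[OF meas]]) simp
  moreover have "(\<lambda>z. u z - v z) -` (- {0}) \<inter> space spacetime = ?A"
    by (auto simp: space_restrict_space)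
  ultimately have "?A \<in> sets lebesgue"
    using Q by (simp add: sets_restrict_space_iff)
  then obtain S N N' where A: "?A = S \<union> N" "N \<subseteq> N'" and N': "N' \<in> null_sets lborel" and S: "S \<in> sets lborel"
    by (rule sets_completionE)
  have "AE t in lborel. t \<in> {0..<1} \<longrightarrow> (AE x in lborel. x \<in> {0..<1} \<times> {0..<1} \<longrightarrow> u (t, x) = v (t, x))"
    using slices sets_unit_square by (simp add: AE_restrict_space_iff AE_completion_iff)
  then have "AE t in lborel. AE x in lborel. (t, x) \<notin> S"
  proof eventually_elim
    case (elim t)
    show ?case
    proof (cases "t \<in> {0..<1}")
      case True
      then have "AE x in lborel. x \<in> {0..<1} \<times> {0..<1} \<longrightarrow> u (t, x) = v (t, x)" using elim by blast
      then show ?thesis by eventually_elim (use A in auto)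
    next
      case False
      have "S \<subseteq> ?Q" using A(1) by blast
      with False show ?thesis by (intro AE_I2) blast
    qed
  qed
  moreover have "{z \<in> space (lborel \<Otimes>\<^sub>M lborel). z \<notin> S} \<in> sets (lborel \<Otimes>\<^sub>M lborel)"
    unfolding lborel_prod using borel_comp[of S] S by (simp add: Compl_eq)
  ultimately have "AE z in lborel \<Otimes>\<^sub>M lborel. z \<notin> S"
    by (intro lborel_pair.AE_pair_measure)
  then have "AE z in lborel. z \<notin> S" unfolding lborel_prod .
  moreover have "AE z in lborel. z \<notin> N'" by (rule AE_not_in[OF N'])
  ultimately have "AE z in lborel. z \<in> ?Q \<longrightarrow> u z = v z"
    by eventually_elim (use A in auto)
  then show ?thesis
    using Q by (simp add: AE_restrict_space_iff AE_completion_iff)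
qed

section \<open>Characters on space-time\<close>

text \<open>
  The sign of the time frequency is that of the propagator, so that the plane wave with frequency
  \<open>n\<close> evolves into the character with frequency \<open>(n, H n)\<close>.
\<close>

definition spacetime_char :: "(int \<times> int) \<times> int \<Rightarrow> real \<times> real \<times> real \<Rightarrow> complex" where
  "spacetime_char k z = exp (2 * of_real pi * \<i> * of_real (freq_dot (snd z) (fst k) - fst z * of_int (snd k)))"

lemma continuous_spacetime_char: "continuous_on S (spacetime_char k)"
  unfolding spacetime_char_def freq_dot_def by (intro continuous_intros)

lemma continuous_integrable_spacetime:
  fixes f :: "real \<times> real \<times> real \<Rightarrow> 'b::euclidean_space"
  assumes "continuous_on UNIV f"
  shows "integrable spacetime f"
proof -
  have Q: "{0..<1::real} \<times> {0..<1::real} \<times> {0..<1::real} \<in> sets lebesgue"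
    by (intro sets_completionI_sets) (simp add: borel_prod[symmetric])
  have "integrable (lebesgue_on (cbox (0, 0, 0) (1, 1, 1))) f"
    by (rule continuous_imp_integrable) (rule continuous_on_subset[OF assms], simp)
  then have "set_integrable lebesgue (cbox (0, 0, 0) (1, 1, 1)) f"
    unfolding set_integrable_def by (subst (asm) integrable_restrict_space) auto
  then have "set_integrable lebesgue ({0..<1} \<times> {0..<1} \<times> {0..<1}) f"
    by (rule set_integrable_subset) (use Q in \<open>auto simp: cbox_Pair_eq\<close>)
  then show ?thesis
    unfolding set_integrable_def
    using Q by (subst integrable_restrict_space) auto
qed

lemma integral_spacetime_char:
  "(LINT z|spacetime. spacetime_char k z) = (if k = ((0, 0), 0) then 1 else 0)"
proof -
  obtain n h where k: "k = (n, h)" by (cases k)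
  let ?Q2 = "{0..<1::real} \<times> {0..<1::real}" and ?Q3 = "{0..<1::real} \<times> {0..<1::real} \<times> {0..<1::real}"
  let ?a = "\<lambda>t. indicator {0..<1} t *\<^sub>R exp (2 * of_real pi * \<i> * of_real (t * of_int (- h))) :: complex"
  let ?b = "\<lambda>x. indicator ?Q2 x *\<^sub>R exp (2 * of_real pi * \<i> * of_real (freq_dot x n)) :: complex"
  let ?F = "\<lambda>z. indicator ?Q3 z *\<^sub>R spacetime_char k z"
  have Q2: "?Q2 \<in> sets borel" by (simp add: borel_prod[symmetric])
  have Q3: "?Q3 \<in> sets borel" by (simp add: borel_prod[symmetric])
  have F: "?F = (\<lambda>(t, x). ?a t * ?b x)"
    by (auto simp: fun_eq_iff k spacetime_char_def indicator_def exp_add[symmetric] algebra_simps)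
  have "integrable spacetime (spacetime_char k)"
    by (rule continuous_integrable_spacetime[OF continuous_spacetime_char])
  then have int': "integrable lebesgue ?F"
    using Q3 by (subst (asm) integrable_restrict_space) auto
  have m: "?F \<in> borel_measurable borel"
    using Q3 by (intro borel_measurable_scaleR borel_measurable_indicator
      borel_measurable_continuous_onI continuous_spacetime_char)
  then have int: "integrable lborel ?F"
    using int' by (simp add: integrable_completion)
  have "(LINT z|spacetime. spacetime_char k z) = integral\<^sup>L lebesgue ?F"
    using Q3 by (intro integral_restrict_space) auto
  also have "\<dots> = integral\<^sup>L lborel ?F"
    using m by (intro integral_completion) simp
  also have "\<dots> = integral\<^sup>L (lborel \<Otimes>\<^sub>M lborel) (\<lambda>(t, x). ?a t * ?b x)"
    unfolding F lborel_prod ..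
  also have "\<dots> = (LINT t|lborel. LINT x|lborel. ?a t * ?b x)"
    using lborel_pair.integral_fst'[of "\<lambda>(t, x). ?a t * ?b x"] int
    unfolding F lborel_prod by simp
  also have "\<dots> = (LINT t|lborel. ?a t * (LINT x|lborel. ?b x))"
    by (simp only: integral_mult_right_zero)
  also have "\<dots> = (LINT t|lborel. ?a t) * (LINT x|lborel. ?b x)"
    by (rule integral_mult_left_zero)
  also have "(LINT x|lborel. ?b x) = integral\<^sup>L lebesgue ?b"
    by (rule integral_completion[symmetric])
       (use Q2 in \<open>intro borel_measurable_scaleR borel_measurable_indicator; auto simp: freq_dot_def
          intro!: borel_measurable_continuous_onI continuous_intros\<close>)
  also have "\<dots> = (LINT x|torus2. exp (2 * of_real pi * \<i> * of_real (freq_dot x n)))"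
    using Q2 by (intro integral_restrict_space[symmetric]) auto
  finally show ?thesis
    unfolding integral_exp_unit_interval integral_exp_torus2 k by auto
qed

lemma spacetime_char_mult_cnj:
  "spacetime_char k z * cnj (spacetime_char l z) = spacetime_char (k - l) z"
  by (simp add: spacetime_char_def exp_cnj exp_add[symmetric] freq_dot_def algebra_simps)

lemma spacetime_char_mult:
  "spacetime_char k z * spacetime_char l z = spacetime_char (k + l) z"
  by (simp add: spacetime_char_def exp_add[symmetric] freq_dot_def algebra_simps)

lemma spacetime_parseval:
  assumes "finite K"
  shows "(LINT z|spacetime. (norm (\<Sum>k\<in>K. b k * spacetime_char k z))\<^sup>2) = (\<Sum>k\<in>K. (norm (b k))\<^sup>2)"
proof -
  let ?s = "\<lambda>z. \<Sum>k\<in>K. b k * spacetime_char k z"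
  have eq: "complex_of_real ((norm (?s z))\<^sup>2) = (\<Sum>k\<in>K. \<Sum>l\<in>K. b k * cnj (b l) * spacetime_char (k - l) z)" for z
    unfolding complex_norm_square cnj_sum sum_product
    by (simp add: spacetime_char_mult_cnj[symmetric] mult_ac)
  have "complex_of_real (LINT z|spacetime. (norm (?s z))\<^sup>2) = (LINT z|spacetime. complex_of_real ((norm (?s z))\<^sup>2))"
    by (rule integral_complex_of_real[symmetric])
  also have "\<dots> = (\<Sum>k\<in>K. \<Sum>l\<in>K. LINT z|spacetime. b k * cnj (b l) * spacetime_char (k - l) z)"
    unfolding eq
    by (subst Bochner_Integration.integral_sum;
        (intro Bochner_Integration.integrable_sum integrable_mult_right continuous_integrable_spacetime continuous_spacetime_char)?)
       (intro sum.cong refl Bochner_Integration.integral_sum integrable_mult_right continuous_integrable_spacetime continuous_spacetime_char)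
  also have "\<dots> = (\<Sum>k\<in>K. \<Sum>l\<in>K. if k = l then b k * cnj (b l) else 0)"
    by (intro sum.cong refl) (auto simp: integral_spacetime_char zero_prod_def[symmetric])
  also have "\<dots> = complex_of_real (\<Sum>k\<in>K. (norm (b k))\<^sup>2)"
    using assms by (simp add: complex_norm_square del: of_real_power)
  finally show ?thesis by (simp only: of_real_eq_iff)
qed

section \<open>Counting resonances\<close>

text \<open>Cauchy--Schwarz on each fibre, which costs the size of the fibre.\<close>

lemma sum_fibre_square_le:
  fixes w :: "'a \<Rightarrow> complex" and \<phi> :: "'a \<Rightarrow> 'b"
  assumes P: "finite P" and R: "\<And>k. real (card {p \<in> P. \<phi> p = k}) \<le> R"
  shows "(\<Sum>k\<in>\<phi> ` P. (norm (\<Sum>p | p \<in> P \<and> \<phi> p = k. w p))\<^sup>2) \<le> R * (\<Sum>p\<in>P. (norm (w p))\<^sup>2)"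
proof -
  have "(norm (\<Sum>p | p \<in> P \<and> \<phi> p = k. w p))\<^sup>2 \<le> R * (\<Sum>p | p \<in> P \<and> \<phi> p = k. (norm (w p))\<^sup>2)" for k
  proof -
    let ?F = "{p \<in> P. \<phi> p = k}"
    have "(norm (\<Sum>p\<in>?F. w p))\<^sup>2 \<le> (\<Sum>p\<in>?F. norm (w p))\<^sup>2"
      by (intro power_mono norm_sum) simp
    also have "\<dots> \<le> (\<Sum>p\<in>?F. (norm (w p))\<^sup>2) * real (card ?F)"
      by (rule sum_squared_le_sum_of_squares)
    also have "\<dots> \<le> (\<Sum>p\<in>?F. (norm (w p))\<^sup>2) * R"
      by (intro mult_left_mono R sum_nonneg) simp
    finally show ?thesis by (simp add: mult.commute)
  qed
  then have "(\<Sum>k\<in>\<phi> ` P. (norm (\<Sum>p | p \<in> P \<and> \<phi> p = k. w p))\<^sup>2)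
      \<le> (\<Sum>k\<in>\<phi> ` P. R * (\<Sum>p | p \<in> P \<and> \<phi> p = k. (norm (w p))\<^sup>2))"
    by (rule sum_mono)
  also have "\<dots> = R * (\<Sum>p\<in>P. (norm (w p))\<^sup>2)"
    by (simp add: sum_distrib_left[symmetric] sum.image_gen[OF P, symmetric])
  finally show ?thesis .
qed

lemma card_int_interval_le:
  fixes N :: real assumes "N \<ge> 1"
  shows "finite {x::int. - N < of_int x \<and> of_int x \<le> N}" "real (card {x::int. - N < of_int x \<and> of_int x \<le> N}) \<le> 3 * N"
proof -
  have eq: "{x::int. - N < of_int x \<and> of_int x \<le> N} = {\<lfloor>- N\<rfloor> + 1..\<lfloor>N\<rfloor>}"
    by (auto simp: floor_less_iff le_floor_iff; linarith)
  show "finite {x::int. - N < of_int x \<and> of_int x \<le> N}" unfolding eq by simp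
  have "real (card {x::int. - N < of_int x \<and> of_int x \<le> N}) = of_int (\<lfloor>N\<rfloor> - \<lfloor>- N\<rfloor>)"
    unfolding eq using assms by (simp add: of_nat_nat) linarith
  also have "\<dots> \<le> 3 * N" using assms by (simp; linarith)
  finally show "real (card {x::int. - N < of_int x \<and> of_int x \<le> N}) \<le> 3 * N" .
qed

text \<open>
  Given \<open>m\<close> and \<open>h\<close>, a pair in the fibre is determined by its first member \<open>(x, y)\<close>. For each of
  the at most \<open>3N\<close> values of \<open>x\<close>, the condition on the symbols is a quadratic equation for \<open>y\<close>
  with leading coefficient \<open>-2\<close>, so that \<open>y\<close> takes at most two values, exchanged by
  \<open>y \<mapsto> snd m - y\<close>. The linear growth in \<open>N\<close> is attained: for \<open>m = (0, 0)\<close> and \<open>h = 0\<close> the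
  fibre contains the pairs \<open>(n, -n)\<close> with \<open>n\<close> on a diagonal.
\<close>

lemma card_resonance_le:
  assumes N: "N \<ge> 1"
  shows "real (card {p \<in> freq_box N \<times> freq_box N.
           (fst p + snd p, hyp_symbol (fst p) + hyp_symbol (snd p)) = (m, h)}) \<le> 6 * N"
proof -
  let ?X = "{x::int. - N < of_int x \<and> of_int x \<le> N}"
  let ?F = "{p \<in> freq_box N \<times> freq_box N.
      (fst p + snd p, hyp_symbol (fst p) + hyp_symbol (snd p)) = (m, h)}"
  let ?Fx = "\<lambda>x. {p \<in> ?F. fst (fst p) = x}"
  have two: "card (?Fx x) \<le> 2" for x
  proof (cases "?Fx x = {}")
    case True
    then show ?thesis by (simp only: card.empty)
  next
    case False
    then obtain q where q: "q \<in> ?Fx x" by blast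
    define y where "y = snd (fst q)"
    have eqn: "x\<^sup>2 - z\<^sup>2 + ((fst m - x)\<^sup>2 - (snd m - z)\<^sup>2) = h" if "p \<in> ?Fx x" "z = snd (fst p)" for p z
    proof -
      have "snd p = m - fst p" using that(1) by (auto simp: algebra_simps)
      then show ?thesis using that by (auto simp: hyp_symbol_def)
    qed
    have "?Fx x \<subseteq> (\<lambda>z. ((x, z), m - (x, z))) ` {y, snd m - y}"
    proof
      fix p assume p: "p \<in> ?Fx x"
      define z where "z = snd (fst p)"
      have "2 * ((z - y) * (z + y - snd m)) = 0"
        using eqn[OF p z_def] eqn[OF q y_def] by (simp add: power2_eq_square algebra_simps)
      then have "z \<in> {y, snd m - y}" by auto
      moreover have "p = ((x, z), m - (x, z))"
        using p unfolding z_def by (cases p) (auto simp: algebra_simps)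
      ultimately show "p \<in> (\<lambda>z. ((x, z), m - (x, z))) ` {y, snd m - y}" by blast
    qed
    then have "card (?Fx x) \<le> card ((\<lambda>z. ((x, z), m - (x, z))) ` {y, snd m - y})"
      by (intro card_mono) auto
    also have "\<dots> \<le> card {y, snd m - y}" by (rule card_image_le) simp
    also have "\<dots> \<le> 2" by (simp add: card_insert_if)
    finally show ?thesis .
  qed
  have "?F = (\<Union>x\<in>?X. ?Fx x)" by (auto simp: freq_box_def)
  then have "card ?F = card (\<Union>x\<in>?X. ?Fx x)" by (rule arg_cong)
  also have "\<dots> \<le> (\<Sum>x\<in>?X. card (?Fx x))"
    by (rule card_UN_le[OF card_int_interval_le(1)[OF N]])
  also have "\<dots> \<le> (\<Sum>x\<in>?X. 2)" by (intro sum_mono two)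
  finally have "real (card ?F) \<le> 2 * real (card ?X)" by simp
  then show ?thesis using card_int_interval_le(2)[OF N] by linarith
qed

section \<open>The energy of the Fourier coefficients\<close>

lemma Lp_fun_2_iff:
  "f \<in> Lp_fun 2 M \<longleftrightarrow> f \<in> borel_measurable M \<and> integrable M (\<lambda>x. (norm (f x))\<^sup>2)"
  by (simp add: Lp_fun_def)

lemma Lp_fun_2_imp_integrable:
  assumes "f \<in> Lp_fun 2 torus2"
  shows "integrable torus2 f"
proof (rule Bochner_Integration.integrable_bound)
  show "integrable torus2 (\<lambda>x. 1 + (norm (f x))\<^sup>2)"
    using assms continuous_integrable_torus2[OF continuous_on_const[of UNIV "1 :: real"]]
    by (intro Bochner_Integration.integrable_add) (simp_all add: Lp_fun_2_iff)
  show "f \<in> borel_measurable torus2" using assms by (simp add: Lp_fun_2_iff)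
  have "norm z \<le> 1 + (norm z)\<^sup>2" for z :: complex
  proof -
    have "0 \<le> (norm z - 1)\<^sup>2" "0 \<le> norm z" by auto
    then show ?thesis unfolding power2_diff power_one mult_1_right by linarith
  qed
  then show "AE x in torus2. norm (f x) \<le> norm (1 + (norm (f x))\<^sup>2)"
    by (intro AE_I2) (simp add: abs_of_nonneg add_nonneg_nonneg)
qed

text \<open>
  Expand the nonnegative integral of \<open>|f - T|\<^sup>2\<close>, where \<open>T\<close> is the partial Fourier sum of \<open>f\<close> over
  \<open>A\<close>: the pairings of \<open>f\<close> and of \<open>T\<close> with \<open>T\<close> are both equal to the sum on the left.
\<close>

lemma bessel_inequality:
  assumes f: "f \<in> Lp_fun 2 torus2" and A: "finite A"
  shows "(\<Sum>n\<in>A. (norm (fourier_coeff f n))\<^sup>2) \<le> (LINT x|torus2. (norm (f x))\<^sup>2)"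
proof -
  let ?T = "trig_poly A (fourier_coeff f)"
  let ?S = "\<Sum>n\<in>A. (norm (fourier_coeff f n))\<^sup>2"
  have f1: "integrable torus2 f" by (rule Lp_fun_2_imp_integrable[OF f])
  have f2: "integrable torus2 (\<lambda>x. (norm (f x))\<^sup>2)" using f by (simp add: Lp_fun_2_iff)
  have T1: "integrable torus2 ?T" by (rule continuous_integrable_torus2[OF continuous_trig_poly])
  have fT: "integrable torus2 (\<lambda>x. f x * cnj (?T x))" and TT: "integrable torus2 (\<lambda>x. ?T x * cnj (?T x))"
    by (intro integrable_mult_continuous_torus2 f1 T1 continuous_on_cnj continuous_trig_poly)+
  have ifT: "(LINT x|torus2. f x * cnj (?T x)) = of_real ?S"
    unfolding integral_mult_cnj_trig_poly[OF f1] by (simp add: complex_norm_square mult.commute del: of_real_power)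
  have iTT: "(LINT x|torus2. ?T x * cnj (?T x)) = of_real ?S"
    unfolding integral_mult_cnj_trig_poly[OF T1]
    by (simp add: fourier_coeff_trig_poly[OF A] complex_norm_square mult.commute del: of_real_power)
  have eq: "(norm (f x - ?T x))\<^sup>2 = (norm (f x))\<^sup>2 - 2 * Re (f x * cnj (?T x)) + Re (?T x * cnj (?T x))" for x
    unfolding cmod_power2 by (simp add: power2_eq_square algebra_simps)
  have "0 \<le> (LINT x|torus2. (norm (f x - ?T x))\<^sup>2)" by simp
  also have "\<dots> = (LINT x|torus2. (norm (f x))\<^sup>2) - 2 * (LINT x|torus2. Re (f x * cnj (?T x)))
      + (LINT x|torus2. Re (?T x * cnj (?T x)))"
    unfolding eq using f2 fT TT integrable_Re[OF fT] integrable_Re[OF TT] by (simp del: times_complex.sel)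
  also have "\<dots> = (LINT x|torus2. (norm (f x))\<^sup>2) - 2 * ?S + ?S"
    using integral_Re[OF fT] integral_Re[OF TT] unfolding ifT iTT Re_complex_of_real by presburger
  finally show ?thesis by simp
qed

lemma fourier_coeff_diff:
  assumes "integrable torus2 f" "integrable torus2 g"
  shows "fourier_coeff (\<lambda>x. f x - g x) n = fourier_coeff f n - fourier_coeff g n"
  unfolding fourier_coeff_def left_diff_distrib
  by (intro Bochner_Integration.integral_diff integrable_mult_continuous_torus2 assms)
     (auto simp: freq_dot_def intro!: continuous_intros)

section \<open>The Strichartz estimate\<close>

definition evolved_poly :: "(int \<times> int) set \<Rightarrow> (int \<times> int \<Rightarrow> complex) \<Rightarrow> real \<times> real \<times> real \<Rightarrow> complex" where
  "evolved_poly A c z = (\<Sum>n\<in>A. c n * spacetime_char (n, hyp_symbol n) z)"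

lemma evolved_poly_slice:
  "evolved_poly A c (t, x) =
     trig_poly A (\<lambda>n. exp (- 2 * of_real pi * \<i> * of_real t * of_int (hyp_symbol n)) * c n) x"
  unfolding evolved_poly_def trig_poly_def spacetime_char_def
  by (intro sum.cong refl) (simp add: mult_ac exp_add[symmetric] algebra_simps)

lemma continuous_evolved_poly: "continuous_on S (evolved_poly A c)"
  unfolding evolved_poly_def by (intro continuous_intros continuous_spacetime_char)

text \<open>
  The fourth power of the \<open>L\<^sup>4\<close> norm is the square of the \<open>L\<^sup>2\<close> norm of the squared function,
  whose frequencies are the sums \<open>(p + q, H p + H q)\<close>. Collecting equal frequencies and applying
  Parseval leaves a sum over the fibres counted by \<open>card_resonance_le\<close>.
\<close>

lemma evolved_poly_L4:
  assumes N: "N \<ge> 1"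
  shows "(LINT z|spacetime. (norm (evolved_poly (freq_box N) c z)) ^ 4)
           \<le> 6 * N * (\<Sum>n\<in>freq_box N. (norm (c n))\<^sup>2)\<^sup>2"
proof -
  let ?B = "freq_box N" and ?P = "freq_box N \<times> freq_box N"
  let ?\<phi> = "\<lambda>p. (fst p + snd p, hyp_symbol (fst p) + hyp_symbol (snd p))"
  let ?w = "\<lambda>p. c (fst p) * c (snd p)"
  let ?b = "\<lambda>k. \<Sum>p | p \<in> ?P \<and> ?\<phi> p = k. ?w p"
  have P: "finite ?P" using finite_freq_box by blast
  have square: "(evolved_poly ?B c z)\<^sup>2 = (\<Sum>k\<in>?\<phi> ` ?P. ?b k * spacetime_char k z)" for z
  proof -
    have "(evolved_poly ?B c z)\<^sup>2 = (\<Sum>p\<in>?P. ?w p * spacetime_char (?\<phi> p) z)"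
      unfolding evolved_poly_def power2_eq_square sum_product sum.cartesian_product
      by (intro sum.cong refl) (auto simp: mult_ac spacetime_char_mult[symmetric] simp flip: add_Pair)
    also have "\<dots> = (\<Sum>k\<in>?\<phi> ` ?P. \<Sum>p | p \<in> ?P \<and> ?\<phi> p = k. ?w p * spacetime_char (?\<phi> p) z)"
      by (rule sum.image_gen[OF P])
    also have "\<dots> = (\<Sum>k\<in>?\<phi> ` ?P. ?b k * spacetime_char k z)"
      unfolding sum_distrib_right by (intro sum.cong refl) auto
    finally show ?thesis .
  qed
  have "(LINT z|spacetime. (norm (evolved_poly ?B c z)) ^ 4)
      = (LINT z|spacetime. (norm (\<Sum>k\<in>?\<phi> ` ?P. ?b k * spacetime_char k z))\<^sup>2)"
    unfolding square[symmetric] by (simp add: norm_power flip: power_mult)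
  also have "\<dots> = (\<Sum>k\<in>?\<phi> ` ?P. (norm (?b k))\<^sup>2)"
    by (rule spacetime_parseval) (use P in blast)
  also have "\<dots> \<le> 6 * N * (\<Sum>p\<in>?P. (norm (?w p))\<^sup>2)"
  proof (rule sum_fibre_square_le[OF P])
    fix k :: "(int \<times> int) \<times> int"
    show "real (card {p \<in> ?P. ?\<phi> p = k}) \<le> 6 * N"
      using card_resonance_le[OF N, of "fst k" "snd k"] by simp
  qed
  also have "(\<Sum>p\<in>?P. (norm (?w p))\<^sup>2) = (\<Sum>n\<in>?B. (norm (c n))\<^sup>2)\<^sup>2"
    unfolding power2_eq_square[of "\<Sum>n\<in>?B. _ n"] sum_product sum.cartesian_product
    by (intro sum.cong refl) (auto simp: norm_mult power_mult_distrib)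
  finally show ?thesis .
qed

text \<open>
  Almost every slice of \<open>u\<close> has the Fourier coefficients of a trigonometric polynomial, hence
  coincides with it almost everywhere. This replaces an arbitrary representative by an explicit
  continuous function.
\<close>

lemma hyp_evolution_AE_eq:
  assumes f: "f \<in> Lp_fun 2 torus2" and g: "g \<in> proj_le N f" and u: "u \<in> hyp_evolution g"
  shows "AE z in spacetime. u z = evolved_poly (freq_box N) (fourier_coeff f) z"
proof (rule AE_spacetime_of_slices)
  let ?U = "evolved_poly (freq_box N) (fourier_coeff f)"
  show "u \<in> borel_measurable spacetime" using u by (simp add: hyp_evolution_def)
  show "?U \<in> borel_measurable spacetime"
    by (intro borel_measurable_integrable continuous_integrable_spacetime continuous_evolved_poly)
  have "AE t in torus_time. (\<lambda>x. u (t, x)) \<in> hyp_propagator t g"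
    using u by (simp add: hyp_evolution_def)
  then show "AE t in torus_time. AE x in torus2. u (t, x) = ?U (t, x)"
  proof eventually_elim
    case (elim t)
    let ?c = "\<lambda>n. exp (- 2 * of_real pi * \<i> * of_real t * of_int (hyp_symbol n)) * fourier_coeff f n"
    have slice: "(\<lambda>x. ?U (t, x)) = trig_poly (freq_box N) ?c"
      by (simp add: evolved_poly_slice fun_eq_iff)
    have u1: "integrable torus2 (\<lambda>x. u (t, x))"
      using elim by (intro Lp_fun_2_imp_integrable) (simp add: hyp_propagator_def)
    have U1: "integrable torus2 (\<lambda>x. ?U (t, x))"
      unfolding slice by (rule continuous_integrable_torus2[OF continuous_trig_poly])
    have "AE x in torus2. u (t, x) - ?U (t, x) = 0"
    proof (rule fourier_coeff_zero_imp_AE_zero)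
      show "integrable torus2 (\<lambda>x. u (t, x) - ?U (t, x))"
        using u1 U1 by (rule Bochner_Integration.integrable_diff)
      fix n
      have "fourier_coeff (\<lambda>x. u (t, x)) n =
          exp (- 2 * of_real pi * \<i> * of_real t * of_int (hyp_symbol n)) * (indicator (freq_box N) n * fourier_coeff f n)"
        using elim g by (cases n) (simp add: hyp_propagator_def proj_le_def)
      also have "\<dots> = fourier_coeff (\<lambda>x. ?U (t, x)) n"
        unfolding slice fourier_coeff_trig_poly[OF finite_freq_box] by (simp add: indicator_def)
      finally show "fourier_coeff (\<lambda>x. u (t, x) - ?U (t, x)) n = 0"
        unfolding fourier_coeff_diff[OF u1 U1] by simp
    qed
    then show ?case by simp
  qed
qed

theorem theorem2p1:
  shows "\<exists>C::real. C > 0 \<and>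
    (\<forall>N::real. N \<ge> 1 \<longrightarrow>
      (\<forall>f \<in> Lp_fun 2 torus2. \<forall>g \<in> proj_le N f. \<forall>u \<in> hyp_evolution g.
         u \<in> Lp_fun 4 spacetime \<and>
         Lp_norm 4 spacetime u \<le> C * N powr (1 / 4) * Lp_norm 2 torus2 f))"
proof (intro exI[of _ "6 powr (1 / 4)"] conjI allI impI ballI)
  fix N :: real and f g u
  assume N: "N \<ge> 1" and f: "f \<in> Lp_fun 2 torus2" and g: "g \<in> proj_le N f" and u: "u \<in> hyp_evolution g"
  let ?U = "evolved_poly (freq_box N) (fourier_coeff f)"
  have AE: "AE z in spacetime. u z = ?U z"
    by (rule hyp_evolution_AE_eq[OF f g u])
  have u_meas: "u \<in> borel_measurable spacetime" using u by (simp add: hyp_evolution_def)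
  have U4: "integrable spacetime (\<lambda>z. norm (?U z) ^ 4)"
    by (intro continuous_integrable_spacetime continuous_intros continuous_evolved_poly)
  have u_meas4: "(\<lambda>z. norm (u z) ^ 4) \<in> borel_measurable spacetime"
    using u_meas by measurable
  have AE4: "AE z in spacetime. norm (?U z) ^ 4 = norm (u z) ^ 4"
    using AE by eventually_elim simp
  show "u \<in> Lp_fun 4 spacetime"
    using integrable_cong_AE_imp[OF U4 u_meas4 AE4] u_meas by (simp add: Lp_fun_def)
  let ?I = "LINT x|torus2. (norm (f x))\<^sup>2"
  have I: "?I \<ge> 0" by simp
  have "(LINT z|spacetime. norm (u z) ^ 4) = (LINT z|spacetime. norm (?U z) ^ 4)"
    using AE4 by (intro integral_cong_AE u_meas4 borel_measurable_integrable[OF U4]) auto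
  also have "\<dots> \<le> 6 * N * (\<Sum>n\<in>freq_box N. (norm (fourier_coeff f n))\<^sup>2)\<^sup>2"
    by (rule evolved_poly_L4[OF N])
  also have "\<dots> \<le> 6 * N * ?I\<^sup>2"
    using N by (intro mult_left_mono power_mono bessel_inequality f finite_freq_box sum_nonneg) auto
  finally have bound: "(LINT z|spacetime. norm (u z) ^ 4) \<le> 6 * N * ?I\<^sup>2" .
  have "Lp_norm 4 spacetime u = (LINT z|spacetime. norm (u z) ^ 4) powr (1 / 4)"
    by (simp add: Lp_norm_def)
  also have "\<dots> \<le> (6 * N * ?I\<^sup>2) powr (1 / 4)"
    using bound by (intro powr_mono2) auto
  also have "\<dots> = 6 powr (1 / 4) * N powr (1 / 4) * (?I\<^sup>2) powr (1 / 4)"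
    using N by (simp add: powr_mult)
  also have "(?I\<^sup>2) powr (1 / 4) = ?I powr (1 / 2)"
  proof -
    have "?I\<^sup>2 = ?I powr 2" using I by simp
    then show ?thesis by (simp only: powr_powr) simp
  qed
  also have "?I powr (1 / 2) = Lp_norm 2 torus2 f"
    by (simp add: Lp_norm_def)
  finally show "Lp_norm 4 spacetime u \<le> 6 powr (1 / 4) * N powr (1 / 4) * Lp_norm 2 torus2 f" .
qed simp

end
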